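(* If there is a constant $\delta<1$ such that $\rho_j\le\delta$ for all $j\in N_x$, then algorithm $\mathrm{DS}_{\mathrm{Knap}}$ (described in the context) is a polynomial-time $O(\sqrt{\beta})$-approximation algorithm for the Data Store Selection problem, running in time $O(n_x^2\log n_x)$. That is, the returned set $D$ satisfies $\phi(D)\le C\sqrt{\beta}\,\min_{D'\subseteq N_x}\phi(D')$ for a constant $C$ that may depend on $\delta$ only.
   Context: $N_x$ is a finite set of $n_x$ data stores; each $j\in N_x$ has an access cost $c_j\ge 1$ and a misindication ratio $\rho_j\in[0,1]$; $\beta\ge 1$ is the miss penalty. For $D\subseteq N_x$ the expected cost is $\phi(D)=\sum_{j\in D}c_j+\beta\prod_{j\in D}\rho_j$ (empty sum $0$, empty product $1$). The Data Store Selection (DSS) problem is to find $D\subseteq N_x$ minimizing $\phi(D)$. Algorithm $\mathrm{DS}_{\mathrm{Knap}}$: set $w_j=-\log\rho_j$ for $j\in N_x$ (logarithms are base 2, $-\log 0=+\infty$). For each $u\in\{c_j: j\in N_x\}$: let $N_x^u=\{j\in N_x: c_j\le u\}$ and $n_x^u=|N_x^u|$; order $N_x^u$ as $k_1,\dots,k_{n_x^u}$ in non-increasing order of $w_j/c_j$; for every $1\le t\le n_x^u$ let $D_t^u=\{k_1,\dots,k_t\}$ and $\tilde D_t^u=\{k_t\}$. Return a set minimizing $\phi$ among all the sets $D_t^u$, $\tilde D_t^u$ and $\emptyset$. *)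

theory Defs
  imports Complex_Main "HOL-Library.Extended_Real" "HOL-Library.Landau_Symbols"
    "HOL-Library.Monad_Syntax"
begin

section \<open>The Data Store Selection problem\<close>

definition dss_instance :: "'a set \<Rightarrow> ('a \<Rightarrow> real) \<Rightarrow> ('a \<Rightarrow> real) \<Rightarrow> real \<Rightarrow> bool" where
  "dss_instance N c \<rho> \<beta> \<longleftrightarrow>
     finite N \<and> (\<forall>j\<in>N. 1 \<le> c j) \<and> (\<forall>j\<in>N. 0 \<le> \<rho> j \<and> \<rho> j \<le> 1) \<and> 1 \<le> \<beta>"

definition dss_cost :: "('a \<Rightarrow> real) \<Rightarrow> ('a \<Rightarrow> real) \<Rightarrow> real \<Rightarrow> 'a set \<Rightarrow> real" where
  "dss_cost c \<rho> \<beta> D = (\<Sum>j\<in>D. c j) + \<beta> * (\<Prod>j\<in>D. \<rho> j)"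

definition dss_opt :: "'a set \<Rightarrow> ('a \<Rightarrow> real) \<Rightarrow> ('a \<Rightarrow> real) \<Rightarrow> real \<Rightarrow> real" where
  "dss_opt N c \<rho> \<beta> = Min (dss_cost c \<rho> \<beta> ` Pow N)"


section \<open>The algorithm, with arbitrary tie-breaking\<close>

text \<open>The case distinction is needed because \<^term>\<open>log 2 (0::real)\<close> is an ordinary real number
  in HOL.\<close>

definition weight :: "real \<Rightarrow> ereal" where
  "weight r = (if r = 0 then \<infinity> else ereal (- log 2 r))"

definition stores_upto :: "'a set \<Rightarrow> ('a \<Rightarrow> real) \<Rightarrow> real \<Rightarrow> 'a set" where
  "stores_upto N c u = {j \<in> N. c j \<le> u}"

definition density_order :: "('a \<Rightarrow> real) \<Rightarrow> ('a \<Rightarrow> real) \<Rightarrow> 'a set \<Rightarrow> 'a list \<Rightarrow> bool" where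
  "density_order c \<rho> A ks \<longleftrightarrow> distinct ks \<and> set ks = A \<and>
     sorted_wrt (\<lambda>i j. weight (\<rho> j) / ereal (c j) \<le> weight (\<rho> i) / ereal (c i)) ks"

text \<open>\<^term>\<open>ks u\<close> lists $k_1, k_2, \ldots$ for the threshold \<^term>\<open>u\<close>; list positions start at 0.\<close>

definition ds_knap_candidates ::
  "'a set \<Rightarrow> ('a \<Rightarrow> real) \<Rightarrow> (real \<Rightarrow> 'a list) \<Rightarrow> 'a set set" where
  "ds_knap_candidates N c ks =
     {set (take t (ks u)) | u t. u \<in> c ` N \<and> 1 \<le> t \<and> t \<le> length (ks u)} \<union>
     {{ks u ! (t - 1)} | u t. u \<in> c ` N \<and> 1 \<le> t \<and> t \<le> length (ks u)} \<union>
     {{}}"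

text \<open>\<^term>\<open>D\<close> is a possible output of the algorithm: ties in the orderings (independently for each
  threshold) and between minimizers may be broken in any way.\<close>

definition ds_knap_output ::
  "'a set \<Rightarrow> ('a \<Rightarrow> real) \<Rightarrow> ('a \<Rightarrow> real) \<Rightarrow> real \<Rightarrow> 'a set \<Rightarrow> bool" where
  "ds_knap_output N c \<rho> \<beta> D \<longleftrightarrow>
     (\<exists>ks. (\<forall>u \<in> c ` N. density_order c \<rho> (stores_upto N c u) (ks u)) \<and>
           is_arg_min (dss_cost c \<rho> \<beta>) (\<lambda>A. A \<in> ds_knap_candidates N c ks) D)"


section \<open>The algorithm as a step-counting program\<close>

text \<open>
  Unit-cost model over exact (extended) real numbers. One step is charged for each function call
  (including its pattern match, via \<open>tick\<close>), and one for each elementary operation (via \<open>step\<close>):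
  reading a parameter of a store, an arithmetic operation, a logarithm, a comparison of two numbers,
  building a list cell or a record. Sequencing, pairing, selecting components and returning a value
  that is already available are free. Lists are immutable and shared, so adding an element
  in front of a prefix does not copy it.
\<close>

datatype 'b timed = Timed (val: 'b) (steps: nat)

definition ret :: "'b \<Rightarrow> 'b timed" where
  "ret x = Timed x 0"

definition step :: "'b \<Rightarrow> 'b timed" where
  "step x = Timed x 1"

definition tick :: "'b timed \<Rightarrow> 'b timed" where
  "tick m = Timed (val m) (Suc (steps m))"

definition bind_timed :: "'b timed \<Rightarrow> ('b \<Rightarrow> 'd timed) \<Rightarrow> 'd timed" where
  "bind_timed m f = Timed (val (f (val m))) (steps m + steps (f (val m)))"

adhoc_overloading Monad_Syntax.bind \<rightleftharpoons> bind_timed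

lemma val_simps [simp]:
  "val (ret x) = x" "val (step x) = x" "val (tick m) = val m"
  "val (bind_timed m f) = val (f (val m))"
  by (simp_all add: ret_def step_def tick_def bind_timed_def)

lemma steps_simps [simp]:
  "steps (ret x) = 0" "steps (step x) = 1" "steps (tick m) = Suc (steps m)"
  "steps (bind_timed m f) = steps m + steps (f (val m))"
  by (simp_all add: ret_def step_def tick_def bind_timed_def)

lemma bind_timed_cong [fundef_cong]:
  "m = m' \<Longrightarrow> (\<And>x. x = val m' \<Longrightarrow> f x = f' x) \<Longrightarrow> bind_timed m f = bind_timed m' f'"
  by (simp add: bind_timed_def)

datatype 'a item = Item (store: 'a) (acc: real) (mis: real) (density: ereal)

definition make_item :: "('a \<Rightarrow> real) \<Rightarrow> ('a \<Rightarrow> real) \<Rightarrow> 'a \<Rightarrow> 'a item timed" where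
  "make_item c \<rho> j = tick (do {
     a \<leftarrow> step (c j);
     r \<leftarrow> step (\<rho> j);
     zero \<leftarrow> step (r = 0);
     w \<leftarrow> (if zero then step \<infinity> else do { l \<leftarrow> step (log 2 r); step (ereal (- l)) });
     d \<leftarrow> step (w / ereal a);
     step (Item j a r d) })"

fun make_items :: "('a \<Rightarrow> real) \<Rightarrow> ('a \<Rightarrow> real) \<Rightarrow> 'a list \<Rightarrow> 'a item list timed" where
  "make_items c \<rho> [] = tick (ret [])"
| "make_items c \<rho> (j # js) = tick (do {
     x \<leftarrow> make_item c \<rho> j;
     xs \<leftarrow> make_items c \<rho> js;
     step (x # xs) })"

fun filter_upto :: "real \<Rightarrow> 'a item list \<Rightarrow> 'a item list timed" where
  "filter_upto u [] = tick (ret [])"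
| "filter_upto u (x # xs) = tick (do {
     ys \<leftarrow> filter_upto u xs;
     keep \<leftarrow> step (acc x \<le> u);
     if keep then step (x # ys) else ret ys })"

fun halve :: "'a list \<Rightarrow> ('a list \<times> 'a list) timed" where
  "halve [] = tick (ret ([], []))"
| "halve [x] = tick (ret ([x], []))"
| "halve (x # y # zs) = tick (do {
     (xs, ys) \<leftarrow> halve zs;
     xs' \<leftarrow> step (x # xs);
     ys' \<leftarrow> step (y # ys);
     ret (xs', ys') })"

fun merge_desc :: "'a item list \<Rightarrow> 'a item list \<Rightarrow> 'a item list timed" where
  "merge_desc [] ys = tick (ret ys)"
| "merge_desc (x # xs) [] = tick (ret (x # xs))"
| "merge_desc (x # xs) (y # ys) = tick (do {
     first \<leftarrow> step (density y \<le> density x);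
     if first then do { zs \<leftarrow> merge_desc xs (y # ys); step (x # zs) }
     else do { zs \<leftarrow> merge_desc (x # xs) ys; step (y # zs) } })"

lemma length_halve:
  "length (fst (val (halve xs))) + length (snd (val (halve xs))) = length xs"
  "length (snd (val (halve xs))) \<le> length (fst (val (halve xs)))"
  "length (fst (val (halve xs))) \<le> Suc (length (snd (val (halve xs))))"
  by (induction xs rule: halve.induct) (auto simp: case_prod_beta)

function (sequential) msort_desc :: "'a item list \<Rightarrow> 'a item list timed" where
  "msort_desc [] = tick (ret [])"
| "msort_desc [x] = tick (ret [x])"
| "msort_desc (x # y # zs) = tick (do {
     (xs, ys) \<leftarrow> halve (x # y # zs);
     xs' \<leftarrow> msort_desc xs;
     ys' \<leftarrow> msort_desc ys;
     merge_desc xs' ys' })"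
  by pat_completeness auto
termination
proof (relation "measure length", goal_cases)
  case 1
  show ?case by simp
next
  case (2 x y zs p xs ys)
  then show ?case using length_halve[of zs] by (auto simp: case_prod_beta)
next
  case (3 x y zs p xs ys)
  then show ?case using length_halve[of zs] by (auto simp: case_prod_beta)
qed

text \<open>A candidate is stored together with its expected cost.\<close>

definition better :: "'a list \<times> real \<Rightarrow> 'a list \<times> real \<Rightarrow> ('a list \<times> real) timed" where
  "better p q = tick (do { less \<leftarrow> step (snd q < snd p); ret (if less then q else p) })"

text \<open>The arguments \<open>ds\<close>, \<open>a\<close>, \<open>r\<close> are the current prefix (reversed), the sum of its access
  costs and the product of its misindication ratios.\<close>

fun scan :: "real \<Rightarrow> 'a list \<Rightarrow> real \<Rightarrow> real \<Rightarrow> 'a item list \<Rightarrow> 'a list \<times> real \<Rightarrow>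
    ('a list \<times> real) timed" where
  "scan \<beta> ds a r [] best = tick (ret best)"
| "scan \<beta> ds a r (x # xs) best = tick (do {
     ds' \<leftarrow> step (store x # ds);
     a' \<leftarrow> step (a + acc x);
     r' \<leftarrow> step (r * mis x);
     m \<leftarrow> step (\<beta> * r');
     f \<leftarrow> step (a' + m);
     best' \<leftarrow> better best (ds', f);
     ds1 \<leftarrow> step [store x];
     m1 \<leftarrow> step (\<beta> * mis x);
     f1 \<leftarrow> step (acc x + m1);
     best'' \<leftarrow> better best' (ds1, f1);
     scan \<beta> ds' a' r' xs best'' })"

text \<open>One round for every store in the third argument, with its access cost as the threshold.
  A threshold shared by several stores is processed repeatedly, with the same candidates.\<close>

fun threshold_loop :: "real \<Rightarrow> 'a item list \<Rightarrow> 'a item list \<Rightarrow> 'a list \<times> real \<Rightarrow>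
    ('a list \<times> real) timed" where
  "threshold_loop \<beta> items [] best = tick (ret best)"
| "threshold_loop \<beta> items (x # xs) best = tick (do {
     ys \<leftarrow> filter_upto (acc x) items;
     ks \<leftarrow> msort_desc ys;
     best' \<leftarrow> scan \<beta> [] 0 1 ks best;
     threshold_loop \<beta> items xs best' })"

definition ds_knap :: "'a list \<Rightarrow> ('a \<Rightarrow> real) \<Rightarrow> ('a \<Rightarrow> real) \<Rightarrow> real \<Rightarrow> 'a list timed" where
  "ds_knap js c \<rho> \<beta> = tick (do {
     items \<leftarrow> make_items c \<rho> js;
     best \<leftarrow> threshold_loop \<beta> items items ([], \<beta>);
     ret (fst best) })"

end

theory Submission
  imports Defs "HOL-Library.Multiset"
begin

text \<open>
  Let \<open>E\<close> be an optimal set, \<open>E \<noteq> {}\<close>, and consider the threshold \<open>u = max {c j | j \<in> E}\<close>.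
  Cut the density order at the first store \<open>k\<close> that makes the total cost of the prefix exceed the
  cost of \<open>E\<close>. As for the fractional knapsack problem, the prefix including \<open>k\<close> weighs at least
  as much as \<open>E\<close>, so the prefix without \<open>k\<close>, or \<open>{k}\<close> alone, has at least half the weight of
  \<open>E\<close>; neither costs more than \<open>E\<close>, since \<open>c k \<le> u\<close>. Half the weight means at most the square
  root of the product of misindication ratios, and
  $s + \beta\sqrt{P} \le 2\sqrt{\beta}\,(s + \beta P)$ for $s \ge 1$.
\<close>

section \<open>Running time\<close>

text \<open>A store with nonzero ratio costs most: eight steps in \<open>make_item\<close>, then one
  for the call and one for the list cell.\<close>

lemma steps_make_items: "steps (make_items c \<rho> js) \<le> 10 * length js + 1"
  by (induction js) (auto simp: make_item_def)

lemma steps_filter_upto: "steps (filter_upto u xs) \<le> 3 * length xs + 1"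
  by (induction xs) auto

lemma steps_halve: "steps (halve xs) \<le> 2 * length xs + 1"
  by (induction xs rule: halve.induct) (auto simp: case_prod_beta)

lemma steps_merge_desc: "steps (merge_desc xs ys) \<le> 3 * (length xs + length ys) + 1"
  by (induction xs ys rule: merge_desc.induct) auto

section \<open>Merge sort: preserved elements and number of steps\<close>

lemma mset_halve:
  "mset (fst (val (halve xs))) + mset (snd (val (halve xs))) = mset xs"
  by (induction xs rule: halve.induct) (auto simp: case_prod_beta)

lemma mset_merge_desc: "mset (val (merge_desc xs ys)) = mset xs + mset ys"
  by (induction xs ys rule: merge_desc.induct) auto

lemma mset_msort_desc: "mset (val (msort_desc xs)) = mset xs"
proof (induction xs rule: msort_desc.induct)
  case (3 x y zs)
  show ?case
    using 3(1)[OF refl surjective_pairing[symmetric]]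
      3(2)[OF refl surjective_pairing[symmetric] refl] mset_halve[of "x # y # zs"]
    by (simp add: case_prod_beta mset_merge_desc del: halve.simps)
qed auto

lemma length_msort_desc: "length (val (msort_desc xs)) = length xs"
  by (metis mset_msort_desc size_mset)

text \<open>Halving and merging cost about five steps per element on each level of the recursion.
  Seven absorbs the constant overhead, because a list that is split has at least two elements.
  Allowing any \<open>k\<close> with \<open>length xs \<le> 2 ^ k\<close> keeps logarithms out of
  the induction: both halves are handled with \<open>k - 1\<close>.\<close>

lemma steps_msort_desc:
  "length xs \<le> 2 ^ k \<Longrightarrow> steps (msort_desc xs) \<le> 7 * k * length xs + 1"
proof (induction xs arbitrary: k rule: msort_desc.induct)
  case (3 x y zs)
  define xs where "xs = x # y # zs"
  define l r where "l = fst (val (halve xs))" and "r = snd (val (halve xs))"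
  obtain m where k: "k = Suc m"
    using 3(3) by (cases k) auto
  have len: "length l + length r = length xs" "length r \<le> length l" "length l \<le> Suc (length r)"
    using length_halve[of xs] by (auto simp: l_def r_def)
  have half: "length l \<le> 2 ^ m" "length r \<le> 2 ^ m"
    using 3(3) len unfolding k by (auto simp flip: xs_def)
  have "steps (msort_desc l) \<le> 7 * m * length l + 1"
    using 3(1)[OF refl surjective_pairing[symmetric], of m] half
    by (simp add: l_def r_def xs_def del: halve.simps)
  moreover have "steps (msort_desc r) \<le> 7 * m * length r + 1"
    using 3(2)[OF refl surjective_pairing[symmetric] refl, of m] half
    by (simp add: l_def r_def xs_def del: halve.simps)
  moreover have "steps (msort_desc xs) = Suc (steps (halve xs) + (steps (msort_desc l)
      + (steps (msort_desc r) + steps (merge_desc (val (msort_desc l)) (val (msort_desc r))))))"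
    by (simp add: l_def r_def xs_def case_prod_beta del: halve.simps)
  moreover have "steps (merge_desc (val (msort_desc l)) (val (msort_desc r))) \<le> 3 * length xs + 1"
    using steps_merge_desc[of "val (msort_desc l)" "val (msort_desc r)"] len
    by (simp add: length_msort_desc)
  moreover have "steps (halve xs) \<le> 2 * length xs + 1"
    by (rule steps_halve)
  moreover have "7 * m * length l + 7 * m * length r = 7 * m * length xs"
    by (simp flip: len(1) add: algebra_simps)
  moreover have "2 \<le> length xs"
    by (simp add: xs_def)
  ultimately have "steps (msort_desc xs) \<le> 7 * m * length xs + 7 * length xs + 1"
    by linarith
  then show ?case
    by (simp add: k xs_def[symmetric] algebra_simps del: msort_desc.simps)
qed auto

text \<open>Thirteen per store: one for the call, eight elementary operations, and two for each of
  the two calls of \<open>better\<close>.\<close>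

lemma steps_scan: "steps (scan \<beta> ds a r xs best) \<le> 13 * length xs + 1"
  by (induction \<beta> ds a r xs best rule: scan.induct) (auto simp: better_def)

lemma val_make_items:
  "val (make_items c \<rho> js) = map (\<lambda>j. Item j (c j) (\<rho> j) (weight (\<rho> j) / ereal (c j))) js"
  by (induction js) (auto simp: make_item_def weight_def)

lemma val_filter_upto: "val (filter_upto u xs) = filter (\<lambda>x. acc x \<le> u) xs"
  by (induction xs) auto

text \<open>One round adds the bounds for filtering, sorting and scanning. The same \<open>k\<close>
  serves all rounds, since a filtered list is no longer than \<open>items\<close>.\<close>

lemma steps_threshold_loop:
  assumes "length items \<le> 2 ^ k"
  shows "steps (threshold_loop \<beta> items xs best)
    \<le> (4 + 16 * length items + 7 * k * length items) * length xs + 1"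
proof (induction xs arbitrary: best)
  case (Cons x xs)
  define ys where "ys = val (filter_upto (acc x) items)"
  have ys: "length ys \<le> length items"
    by (simp add: ys_def val_filter_upto)
  have "steps (msort_desc ys) \<le> 7 * k * length ys + 1"
    using ys assms by (intro steps_msort_desc) simp
  also have "\<dots> \<le> 7 * k * length items + 1"
    using ys by simp
  finally have "steps (msort_desc ys) \<le> 7 * k * length items + 1" .
  moreover have "steps (scan \<beta> [] 0 1 (val (msort_desc ys)) best) \<le> 13 * length items + 1"
    using steps_scan[of \<beta> "[]" 0 1 "val (msort_desc ys)" best] ys by (simp add: length_msort_desc)
  ultimately show ?case
    using steps_filter_upto[of "acc x" items]
      Cons.IH[of "val (scan \<beta> [] 0 1 (val (msort_desc ys)) best)"]
    by (simp add: ys_def)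
qed auto

lemma steps_ds_knap:
  assumes "length js \<le> 2 ^ k"
  shows "steps (ds_knap js c \<rho> \<beta>) \<le> 3 + 14 * length js + (16 + 7 * k) * (length js)\<^sup>2"
proof -
  define items where "items = val (make_items c \<rho> js)"
  have "length items = length js"
    by (simp add: items_def val_make_items)
  with assms steps_make_items[of c \<rho> js] steps_threshold_loop[of items k \<beta> items "([], \<beta>)"]
  show ?thesis
    by (simp add: ds_knap_def items_def[symmetric] power2_eq_square algebra_simps)
qed

lemma steps_bound_bigo:
  "(\<lambda>n. real (3 + 14 * n + (16 + 7 * nat \<lceil>log 2 (real n)\<rceil>) * n\<^sup>2))
     \<in> O(\<lambda>n. real n ^ 2 * log 2 (real n))"
proof (rule bigoI[of _ 47], rule eventually_sequentiallyI[of 2])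
  \<comment> \<open>The constant is \<open>47 = 3 + 14 + 16 + 7 * 2\<close>: from
    \<open>n = 2\<close> on the logarithm is at least 1, so rounding it up at most doubles it and
    each power of \<open>n\<close> is dominated by the target.\<close>
  fix n :: nat
  assume n: "2 \<le> n"
  define L where "L = log 2 (real n)"
  have L: "1 \<le> L"
    using n by (simp add: L_def)
  have n2: "1 \<le> real n ^ 2" "real n \<le> real n ^ 2"
    using n by (auto simp: power2_eq_square one_le_power simp flip: of_nat_mult)
  have ceil: "real (nat \<lceil>L\<rceil>) \<le> 2 * L"
    using L by linarith
  have n2L: "real n ^ 2 \<le> real n ^ 2 * L"
    using L by (simp add: mult_le_cancel_left1)
  have "real (nat \<lceil>L\<rceil>) * real n ^ 2 \<le> 2 * L * real n ^ 2"
    using ceil by (intro mult_right_mono) auto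
  also have "\<dots> = 2 * (real n ^ 2 * L)"
    by simp
  finally have "real (nat \<lceil>L\<rceil>) * real n ^ 2 \<le> 2 * (real n ^ 2 * L)" .
  moreover have "real (3 + 14 * n + (16 + 7 * nat \<lceil>L\<rceil>) * n\<^sup>2)
      = 3 + 14 * real n + 16 * real n ^ 2 + 7 * (real (nat \<lceil>L\<rceil>) * real n ^ 2)"
    by (simp add: algebra_simps)
  ultimately have "real (3 + 14 * n + (16 + 7 * nat \<lceil>L\<rceil>) * n\<^sup>2) \<le> 47 * (real n ^ 2 * L)"
    using n2 n2L by linarith
  then show "norm (real (3 + 14 * n + (16 + 7 * nat \<lceil>log 2 (real n)\<rceil>) * n\<^sup>2))
      \<le> 47 * norm (real n ^ 2 * log 2 (real n))"
    using L unfolding L_def[symmetric] by simp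
qed


section \<open>The program computes a possible output of the algorithm\<close>

abbreviation denser :: "'a item \<Rightarrow> 'a item \<Rightarrow> bool" where
  "denser x y \<equiv> density y \<le> density x"

lemma set_merge_desc: "set (val (merge_desc xs ys)) = set xs \<union> set ys"
  by (metis mset_merge_desc set_mset_mset set_mset_union)

lemma sorted_merge_desc:
  "sorted_wrt denser xs \<Longrightarrow> sorted_wrt denser ys \<Longrightarrow> sorted_wrt denser (val (merge_desc xs ys))"
  by (induction xs ys rule: merge_desc.induct) (fastforce simp: set_merge_desc)+

lemma sorted_msort_desc: "sorted_wrt denser (val (msort_desc xs))"
  by (induction xs rule: msort_desc.induct) (auto simp: case_prod_beta sorted_merge_desc)

text \<open>The loop invariant: \<open>S\<close> collects the candidates examined so far, and the
  cached cost of the current best one is exact.\<close>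

definition best_among :: "('a set \<Rightarrow> real) \<Rightarrow> 'a set set \<Rightarrow> 'a list \<times> real \<Rightarrow> bool" where
  "best_among \<phi> S p \<longleftrightarrow>
     set (fst p) \<in> S \<and> snd p = \<phi> (set (fst p)) \<and> (\<forall>A\<in>S. snd p \<le> \<phi> A)"

lemma best_among_better:
  "best_among \<phi> S p \<Longrightarrow> f = \<phi> (set ds) \<Longrightarrow> best_among \<phi> (insert (set ds) S) (val (better p (ds, f)))"
  by (fastforce simp: best_among_def better_def)

text \<open>The contribution of a single threshold. The empty set is kept apart, as it is the
  starting value of the loop.\<close>

definition list_candidates :: "'a list \<Rightarrow> 'a set set" where
  "list_candidates ks =
     (\<lambda>t. set (take t ks)) ` {1..length ks} \<union> (\<lambda>k. {k}) ` set ks"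

text \<open>Thresholds are indexed by stores instead of by distinct costs, in step with
  \<open>threshold_loop\<close>. Stores of equal cost give the same list, so the union is
  unaffected.\<close>

lemma ds_knap_candidates_eq:
  "ds_knap_candidates N c ks = insert {} (\<Union>j\<in>N. list_candidates (ks (c j)))"
proof -
  have nth: "\<exists>t. k = ks u ! (t - Suc 0) \<and> Suc 0 \<le> t \<and> t \<le> length (ks u)" if "k \<in> set (ks u)" for u k
    using that by (metis One_nat_def Suc_leI diff_Suc_1 in_set_conv_nth zero_less_Suc)
  show ?thesis
    unfolding ds_knap_candidates_def list_candidates_def
    by (auto dest: nth)
qed

text \<open>The prefix \<open>ds\<close> already read is arbitrary, for the induction. Distinctness
  makes the running sum \<open>a\<close> and product \<open>r\<close> agree with those over the set
  of the extended prefix.\<close>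

lemma best_among_scan:
  assumes "best_among (dss_cost c \<rho> \<beta>) S best"
    and "distinct (ds @ map store xs)"
    and "\<forall>x\<in>set xs. acc x = c (store x) \<and> mis x = \<rho> (store x)"
    and "a = sum c (set ds)" "r = prod \<rho> (set ds)"
  shows "best_among (dss_cost c \<rho> \<beta>)
    (S \<union> (\<lambda>t. set ds \<union> set (take t (map store xs))) ` {1..length xs} \<union> (\<lambda>x. {store x}) ` set xs)
    (val (scan \<beta> ds a r xs best))"
  using assms
proof (induction xs arbitrary: ds a r best S)
  case (Cons x xs)
  define ds' where "ds' = store x # ds"
  define f f1 where "f = a + acc x + \<beta> * (r * mis x)" and "f1 = acc x + \<beta> * mis x"
  define b1 where "b1 = val (better best (ds', f))"
  define b2 where "b2 = val (better b1 ([store x], f1))"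
  have "best_among (dss_cost c \<rho> \<beta>) (insert (set ds') S) b1"
    unfolding b1_def using Cons.prems
    by (intro best_among_better[OF Cons.prems(1)])
      (simp add: ds'_def f_def dss_cost_def algebra_simps)
  then have "best_among (dss_cost c \<rho> \<beta>) (insert {store x} (insert (set ds') S)) b2"
    unfolding b2_def using Cons.prems best_among_better[of "dss_cost c \<rho> \<beta>" _ b1 f1 "[store x]"]
    by (simp add: f1_def dss_cost_def[of _ _ _ "{_}"])
  from Cons.IH[OF this, of ds' "a + acc x" "r * mis x"] Cons.prems
  have "best_among (dss_cost c \<rho> \<beta>)
      (insert {store x} (insert (set ds') S)
        \<union> (\<lambda>t. set ds' \<union> set (take t (map store xs))) ` {1..length xs} \<union> (\<lambda>x. {store x}) ` set xs)
      (val (scan \<beta> ds' (a + acc x) (r * mis x) xs b2))"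
    by (auto simp: ds'_def algebra_simps)
  \<comment> \<open>Position 1 yields \<open>set ds'\<close> itself; every later position is one of
    the tail, shifted by one.\<close>
  moreover have range: "{1..length (x # xs)} = insert 1 (Suc ` {1..length xs})"
    by (auto simp: image_iff Suc_le_eq)
  have "insert {store x} (insert (set ds') S)
        \<union> (\<lambda>t. set ds' \<union> set (take t (map store xs))) ` {1..length xs} \<union> (\<lambda>x. {store x}) ` set xs
      = S \<union> (\<lambda>t. set ds \<union> set (take t (map store (x # xs)))) ` {1..length (x # xs)}
        \<union> (\<lambda>x. {store x}) ` set (x # xs)"
    unfolding range
    by (simp add: ds'_def image_image Un_ac insert_commute del: image_Suc_atLeastAtMost)
  ultimately show ?case
    by (simp add: b2_def b1_def ds'_def f_def f1_def)
qed simp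

definition sorted_stores :: "'a item list \<Rightarrow> real \<Rightarrow> 'a list" where
  "sorted_stores items u = map store (val (msort_desc (val (filter_upto u items))))"

lemma best_among_threshold_loop:
  assumes "best_among (dss_cost c \<rho> \<beta>) S best"
    and "distinct (map store items)"
    and "\<forall>x\<in>set items. acc x = c (store x) \<and> mis x = \<rho> (store x)"
  shows "best_among (dss_cost c \<rho> \<beta>)
    (S \<union> (\<Union>x\<in>set xs. list_candidates (sorted_stores items (acc x))))
    (val (threshold_loop \<beta> items xs best))"
  using assms(1)
proof (induction xs arbitrary: S best)
  case (Cons x xs)
  define ks where "ks = val (msort_desc (val (filter_upto (acc x) items)))"
  have mset: "mset ks = mset (filter (\<lambda>y. acc y \<le> acc x) items)"
    by (simp add: ks_def mset_msort_desc val_filter_upto)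
  then have set: "set ks \<subseteq> set items"
    by (metis filter_is_subset set_mset_mset)
  have "distinct (map store (filter (\<lambda>y. acc y \<le> acc x) items))"
    using assms(2) by (rule distinct_map_filter)
  then have dist: "distinct (map store ks)"
    using mset by (metis mset_eq_imp_distinct_iff mset_map)
  have "best_among (dss_cost c \<rho> \<beta>) (S \<union> list_candidates (map store ks))
      (val (scan \<beta> [] 0 1 ks best))"
    using best_among_scan[OF Cons.prems, of "[]" ks 0 1] dist set assms(3)
    by (auto simp: list_candidates_def image_image Un_assoc)
  from Cons.IH[OF this] show ?case
    by (simp add: sorted_stores_def ks_def Un_assoc)
qed simp

text \<open>The ties are broken as merge sort breaks them: \<open>sorted_stores items\<close> is the
  witness for the family of orderings.\<close>

lemma ds_knap_output_val:
  assumes "distinct js" "set js = N"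
  shows "ds_knap_output N c \<rho> \<beta> (set (val (ds_knap js c \<rho> \<beta>)))"
proof -
  define items where "items = val (make_items c \<rho> js)"
  define ks where "ks = sorted_stores items"
  have items: "items = map (\<lambda>j. Item j (c j) (\<rho> j) (weight (\<rho> j) / ereal (c j))) js"
    by (simp add: items_def val_make_items)
  have "density_order c \<rho> (stores_upto N c u) (ks u)" for u
  proof -
    define xs where "xs = val (msort_desc (val (filter_upto u items)))"
    have mset: "mset xs = mset (filter (\<lambda>x. acc x \<le> u) items)"
      by (simp add: xs_def mset_msort_desc val_filter_upto)
    then have set: "set xs = {x \<in> set items. acc x \<le> u}"
      by (metis set_filter set_mset_mset)
    have "distinct (map store (filter (\<lambda>x. acc x \<le> u) items))"
      using assms(1) by (intro distinct_map_filter) (simp add: items comp_def)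
    then have "distinct (map store xs)"
      using mset by (metis mset_eq_imp_distinct_iff mset_map)
    moreover have "store ` set xs = stores_upto N c u"
      using assms(2) by (force simp: set items stores_upto_def)
    moreover have "sorted_wrt (\<lambda>x y. weight (\<rho> (store y)) / ereal (c (store y))
        \<le> weight (\<rho> (store x)) / ereal (c (store x))) xs"
      \<comment> \<open>The stored \<open>density\<close> of each item is by construction the
        quotient that \<open>density_order\<close> compares.\<close>
      by (rule sorted_wrt_mono_rel[OF _ sorted_msort_desc[of "val (filter_upto u items)", folded xs_def]])
        (auto simp: set items)
    ultimately show ?thesis
      by (simp add: density_order_def ks_def sorted_stores_def xs_def[symmetric] sorted_wrt_map)
  qed
  moreover have "best_among (dss_cost c \<rho> \<beta>) (ds_knap_candidates N c ks)
      (val (threshold_loop \<beta> items items ([], \<beta>)))"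
  proof -
    have "best_among (dss_cost c \<rho> \<beta>) {{}} ([], \<beta>)"
      by (simp add: best_among_def dss_cost_def)
    from best_among_threshold_loop[OF this, of items items] show ?thesis
      using assms by (simp add: ds_knap_candidates_eq items ks_def comp_def)
  qed
  ultimately show ?thesis
    unfolding ds_knap_output_def is_arg_min_linorder best_among_def
    by (intro exI[of _ ks]) (auto simp: ds_knap_def items_def[symmetric])
qed


section \<open>Approximation ratio\<close>

text \<open>Let \<open>\<theta>\<close> be the density of the last store taken. The reduced weight
  \<open>w j - \<theta> * c j\<close> is nonnegative on the prefix and nonpositive on the rest of
  \<open>E\<close>, so the prefix has at least the reduced weight of \<open>E\<close>. Since it also
  costs at least as much and \<open>\<theta>\<close> is nonnegative, the comparison carries over to
  \<open>w\<close>.\<close>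

lemma greedy_weight_ge:
  fixes w c :: "'a \<Rightarrow> real"
  assumes sorted: "sorted_wrt (\<lambda>i j. w j / c j \<le> w i / c i) ks"
    and pos: "\<And>j. j \<in> set ks \<Longrightarrow> 0 < c j" "\<And>j. j \<in> set ks \<Longrightarrow> 0 \<le> w j"
    and E: "E \<subseteq> set ks" and t: "t < length ks"
    and cost: "sum c E \<le> sum c (set (take (Suc t) ks))"
  shows "sum w E \<le> sum w (set (take (Suc t) ks))"
proof -
  define A \<theta> where "A = set (take (Suc t) ks)" and "\<theta> = w (ks ! t) / c (ks ! t)"
  have A: "A \<subseteq> set ks"
    unfolding A_def by (rule set_take_subset)
  have fin: "finite E"
    using E finite_subset by blast
  have ratio: "w (ks ! n) / c (ks ! n) \<le> w (ks ! m) / c (ks ! m)" if "m \<le> n" "n < length ks" for m n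
    using sorted_wrt_nth_less[OF sorted, of m n] that by (cases "m = n") auto
  have in_A: "0 \<le> w j - \<theta> * c j" if j: "j \<in> A" for j
  proof -
    obtain m where "j = ks ! m" "m \<le> t"
      using j t by (auto simp: A_def in_set_conv_nth)
    then have "\<theta> \<le> w j / c j"
      using ratio t by (simp add: \<theta>_def)
    then show ?thesis
      using pos(1)[of j] A j by (auto simp: pos_le_divide_eq)
  qed
  have not_A: "w j - \<theta> * c j \<le> 0" if j: "j \<in> E - A" for j
  proof -
    obtain m where m: "j = ks ! m" "m < length ks"
      using j E by (metis DiffD1 in_set_conv_nth subsetD)
    moreover have "t < m"
    proof (rule ccontr)
      assume "\<not> t < m"
      then have "take (Suc t) ks ! m \<in> A"
        unfolding A_def using t by (intro nth_mem) simp
      with \<open>\<not> t < m\<close> j m show False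
        by simp
    qed
    ultimately have "w j / c j \<le> \<theta>"
      using ratio[of t m] by (simp add: \<theta>_def)
    then show ?thesis
      using pos(1)[of j] E j by (auto simp: pos_divide_le_eq)
  qed
  have "(\<Sum>j\<in>E. w j - \<theta> * c j) = (\<Sum>j\<in>E \<inter> A. w j - \<theta> * c j) + (\<Sum>j\<in>E - A. w j - \<theta> * c j)"
    using fin by (rule sum.Int_Diff)
  \<comment> \<open>The nonpositive terms outside \<open>A\<close> are dropped and the nonnegative
    terms of \<open>A - E\<close> are added.\<close>
  also have "\<dots> \<le> (\<Sum>j\<in>A. w j - \<theta> * c j) + 0"
    using in_A not_A by (intro add_mono sum_mono2 sum_nonpos) (auto simp: A_def)
  finally have "sum w E - \<theta> * sum c E \<le> sum w A - \<theta> * sum c A"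
    by (simp add: sum_subtractf sum_distrib_left)
  moreover have "0 \<le> \<theta>"
    using pos[of "ks ! t"] t by (simp add: \<theta>_def)
  then have "\<theta> * sum c E \<le> \<theta> * sum c A"
    using cost by (intro mult_left_mono) (simp_all add: A_def)
  ultimately show ?thesis
    by (simp add: A_def)
qed

text \<open>The prefix before the overflow and the overflowing store together weigh at least as much
  as \<open>E\<close>, so one of them has half of that weight. The prefix fits by minimality of the
  cut, the single store by \<open>fits\<close>.\<close>

lemma ex_candidate_half_weight:
  fixes w c :: "'a \<Rightarrow> real"
  assumes sorted: "sorted_wrt (\<lambda>i j. w j / c j \<le> w i / c i) ks"
    and pos: "\<And>j. j \<in> set ks \<Longrightarrow> 0 < c j" "\<And>j. j \<in> set ks \<Longrightarrow> 0 \<le> w j"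
    and E: "E \<subseteq> set ks" and fits: "\<And>j. j \<in> set ks \<Longrightarrow> c j \<le> sum c E"
  shows "\<exists>X\<in>insert {} (list_candidates ks). sum c X \<le> sum c E \<and> sum w E \<le> 2 * sum w X"
proof (cases "sum c (set ks) \<le> sum c E")
  case True
  have "set ks \<in> insert {} (list_candidates ks)"
    by (cases ks) (force simp: list_candidates_def)+
  moreover have "sum w E \<le> sum w (set ks)" "0 \<le> sum w (set ks)"
    using E pos by (auto intro!: sum_mono2 sum_nonneg)
  ultimately show ?thesis
    using True by (intro bexI[of _ "set ks"]) auto
next
  case False
  define m where "m = (LEAST m. sum c E < sum c (set (take m ks)))"
  have m: "sum c E < sum c (set (take m ks))" "m \<le> length ks"
    unfolding m_def using False by (auto intro: LeastI[of _ "length ks"] Least_le)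
  have "0 \<le> sum c E"
    using E pos(1) by (force intro: sum_nonneg)
  with m obtain t where t: "m = Suc t" "t < length ks"
    by (cases m) auto
  have fit: "sum c (set (take t ks)) \<le> sum c E"
    using not_less_Least[of t "\<lambda>m. sum c E < sum c (set (take m ks))"] t
    by (simp add: m_def)
  have "sum w E \<le> sum w (set (take (Suc t) ks))"
    using m t by (intro greedy_weight_ge[OF sorted pos E]) auto
  \<comment> \<open>Only an inequality, because \<open>ks\<close> may repeat a store here: a
    repetition adds nothing on the left, and its weight on the right is nonnegative.\<close>
  also have "\<dots> \<le> sum w (set (take t ks)) + w (ks ! t)"
    using t pos(2)[of "ks ! t"] by (simp add: take_Suc_conv_app_nth sum.insert_if)
  finally have split: "sum w E \<le> sum w (set (take t ks)) + sum w {ks ! t}"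
    by simp
  \<comment> \<open>Proper prefixes in \<open>list_candidates\<close> start at length 1; the
    inserted empty set covers \<open>t = 0\<close>.\<close>
  have "set (take t ks) \<in> insert {} (list_candidates ks)" "{ks ! t} \<in> list_candidates ks"
    using t by (cases t; force simp: list_candidates_def)+
  moreover have "sum c {ks ! t} \<le> sum c E"
    using fits t by simp
  ultimately show ?thesis
    using split fit by (smt (verit) insert_iff)
qed

section \<open>From weights back to products of misindication ratios\<close>

lemma sum_log_eq_log_prod:
  assumes "\<And>j. j \<in> A \<Longrightarrow> 0 < \<rho> j"
  shows "(\<Sum>j\<in>A. log b (\<rho> j)) = log b (\<Prod>j\<in>A. \<rho> j :: real)"
  using assms
  by (induction A rule: infinite_finite_induct) (auto simp: log_mult prod_pos less_imp_neq[symmetric])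

text \<open>With weights \<open>- log 2 (\<rho> j)\<close>, having at least half the weight of
  \<open>E\<close> means having a product of ratios at most the square root of that of
  \<open>E\<close>. A ratio of 0 has infinite weight and is treated apart, so that the knapsack
  argument stays within the reals.\<close>

lemma ex_candidate_sqrt_prod:
  assumes order: "density_order c \<rho> A ks"
    and bounds: "\<And>j. j \<in> A \<Longrightarrow> 1 \<le> c j" "\<And>j. j \<in> A \<Longrightarrow> 0 \<le> \<rho> j" "\<And>j. j \<in> A \<Longrightarrow> \<rho> j \<le> 1"
    and E: "E \<subseteq> A" and fits: "\<And>j. j \<in> A \<Longrightarrow> c j \<le> sum c E"
  shows "\<exists>X\<in>insert {} (list_candidates ks). sum c X \<le> sum c E \<and> prod \<rho> X \<le> sqrt (prod \<rho> E)"
proof (cases "\<exists>j\<in>A. \<rho> j = 0")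
  case True
  then obtain j where j: "j \<in> A" "\<rho> j = 0"
    by blast
  \<comment> \<open>The singleton \<open>{j}\<close> already has product 0, and it is affordable by
    \<open>fits\<close>.\<close>
  have "0 \<le> prod \<rho> E"
    using E bounds by (auto intro!: prod_nonneg)
  with j order fits show ?thesis
    by (intro bexI[of _ "{j}"]) (auto simp: list_candidates_def density_order_def)
next
  case False
  define w where "w j = - log 2 (\<rho> j)" for j
  have ks: "set ks = A"
    using order by (simp add: density_order_def)
  have \<rho>: "0 < \<rho> j" if "j \<in> A" for j
    using False bounds(2)[OF that] that by force
  have weight: "weight (\<rho> j) / ereal (c j) = ereal (w j / c j)" if "j \<in> A" for j
    using bounds(1)[OF that] \<rho>[OF that] by (simp add: weight_def w_def)
  have "sorted_wrt (\<lambda>i j. weight (\<rho> j) / ereal (c j) \<le> weight (\<rho> i) / ereal (c i)) ks"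
    using order by (simp add: density_order_def)
  then have "sorted_wrt (\<lambda>i j. w j / c j \<le> w i / c i) ks"
    by (rule sorted_wrt_mono_rel[rotated]) (auto simp: ks weight)
  then obtain X where X: "X \<in> insert {} (list_candidates ks)" "sum c X \<le> sum c E"
      "sum w E \<le> 2 * sum w X"
    using ex_candidate_half_weight[of w c ks E] bounds \<rho> E fits ks
    by (force simp: w_def)
  have XA: "X \<subseteq> A"
    using X(1) ks by (auto simp: list_candidates_def dest: in_set_takeD)
  have pos: "0 < prod \<rho> X" "0 < prod \<rho> E"
    using XA E \<rho> by (auto intro!: prod_pos)
  have "2 * log 2 (prod \<rho> X) \<le> log 2 (prod \<rho> E)"
    using X(3) XA E \<rho> by (simp add: w_def sum_negf sum_log_eq_log_prod subset_iff)
  then have "log 2 ((prod \<rho> X)\<^sup>2) \<le> log 2 (prod \<rho> E)"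
    using pos by (simp add: log_nat_power)
  then have "(prod \<rho> X)\<^sup>2 \<le> prod \<rho> E"
    using pos by simp
  then have "prod \<rho> X \<le> sqrt (prod \<rho> E)"
    by (rule real_le_rsqrt)
  with X show ?thesis
    by blast
qed

lemma list_candidates_subset: "X \<in> list_candidates ks \<Longrightarrow> X \<subseteq> set ks"
  by (auto simp: list_candidates_def dest: in_set_takeD)

text \<open>If \<^term>\<open>P \<ge> 1 / \<beta>\<close>, then \<^term>\<open>sqrt P \<le> sqrt \<beta> * P\<close>; otherwise
  \<^term>\<open>\<beta> * sqrt P \<le> sqrt \<beta>\<close>, and \<^term>\<open>1 \<le> s\<close>.\<close>

lemma sqrt_penalty_le:
  fixes s P \<beta> :: real
  assumes "1 \<le> s" "0 \<le> P" "1 \<le> \<beta>"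
  shows "s + \<beta> * sqrt P \<le> 2 * sqrt \<beta> * (s + \<beta> * P)"
proof -
  have b: "1 \<le> sqrt \<beta>" "sqrt \<beta> * sqrt \<beta> = \<beta>"
    using assms by auto
  \<comment> \<open>Since \<open>q\<close> is the square root of \<open>\<beta> * P\<close>, the
    case split at \<open>q = 1\<close> is the one at \<open>P = 1 / \<beta>\<close>.\<close>
  define q where "q = sqrt \<beta> * sqrt P"
  have q: "0 \<le> q" "q * q = \<beta> * P"
    using assms b by (simp_all add: q_def algebra_simps)
  have "q \<le> s + q * q"
  proof (cases "q \<le> 1")
    case False
    then have "q * 1 \<le> q * q" by (intro mult_left_mono) auto
    then show ?thesis using assms by simp
  qed (use assms in \<open>simp add: add_increasing2\<close>)
  then have "sqrt \<beta> * q \<le> sqrt \<beta> * (s + \<beta> * P)"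
    using b q by (intro mult_left_mono) auto
  moreover have "sqrt \<beta> * q = \<beta> * sqrt P"
    using b by (simp add: q_def flip: mult.assoc)
  moreover have "1 * s \<le> sqrt \<beta> * (s + \<beta> * P)"
    using assms b by (intro mult_mono) auto
  ultimately show ?thesis
    by simp
qed

text \<open>The output is no worse than the candidate that the knapsack argument yields for an
  optimal set \<open>E\<close>; the factor 2 comes from \<open>sqrt_penalty_le\<close>. The argument
  works for any admissible orderings \<open>ks\<close>, hence for every way of breaking
  ties.\<close>

lemma ds_knap_output_approx:
  assumes inst: "dss_instance N c \<rho> \<beta>" and D: "ds_knap_output N c \<rho> \<beta> D"
  shows "D \<subseteq> N" "dss_cost c \<rho> \<beta> D \<le> 2 * sqrt \<beta> * dss_opt N c \<rho> \<beta>"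
proof -
  have fin: "finite N" and c: "\<And>j. j \<in> N \<Longrightarrow> 1 \<le> c j" and \<beta>: "1 \<le> \<beta>"
    and \<rho>: "\<And>j. j \<in> N \<Longrightarrow> 0 \<le> \<rho> j" "\<And>j. j \<in> N \<Longrightarrow> \<rho> j \<le> 1"
    using inst by (auto simp: dss_instance_def)
  obtain ks where order: "\<And>u. u \<in> c ` N \<Longrightarrow> density_order c \<rho> (stores_upto N c u) (ks u)"
    and D_in: "D \<in> ds_knap_candidates N c ks"
    and D_le: "\<And>A. A \<in> ds_knap_candidates N c ks \<Longrightarrow> dss_cost c \<rho> \<beta> D \<le> dss_cost c \<rho> \<beta> A"
    using D by (auto simp: ds_knap_output_def is_arg_min_linorder)
  have "set (ks (c j)) \<subseteq> N" if "j \<in> N" for j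
    using order[of "c j"] that by (auto simp: density_order_def stores_upto_def)
  with D_in show "D \<subseteq> N"
    by (fastforce simp: ds_knap_candidates_eq dest: list_candidates_subset)
  have "dss_opt N c \<rho> \<beta> \<in> dss_cost c \<rho> \<beta> ` Pow N"
    unfolding dss_opt_def using fin by (intro Min_in) auto
  then obtain E where E: "E \<subseteq> N" and opt: "dss_opt N c \<rho> \<beta> = dss_cost c \<rho> \<beta> E"
    by auto
  have finE: "finite E"
    using E fin finite_subset by blast
  show "dss_cost c \<rho> \<beta> D \<le> 2 * sqrt \<beta> * dss_opt N c \<rho> \<beta>"
  proof (cases "E = {}")
    case True
    \<comment> \<open>The empty set is itself a candidate, so the output is optimal here.\<close>
    have "dss_cost c \<rho> \<beta> D \<le> 1 * dss_cost c \<rho> \<beta> {}"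
      using D_le[of "{}"] by (simp add: ds_knap_candidates_eq)
    also have "\<dots> \<le> (2 * sqrt \<beta>) * dss_cost c \<rho> \<beta> {}"
      using \<beta> real_sqrt_ge_one[OF \<beta>]
      by (intro mult_right_mono) (simp_all add: dss_cost_def del: real_sqrt_ge_1_iff)
    finally show ?thesis
      using True opt by simp
  next
    case False
    have "Max (c ` E) \<in> c ` E"
      using False finE by (intro Max_in) auto
    then obtain k where k: "k \<in> E" "c k = Max (c ` E)"
      by force
    \<comment> \<open>The largest cost in \<open>E\<close> as threshold keeps all of
      \<open>E\<close>, while every store kept costs at most \<open>c k\<close>, hence at most
      \<open>sum c E\<close>.\<close>
    define A where "A = stores_upto N c (c k)"
    have kN: "k \<in> N" and A: "A \<subseteq> N" "E \<subseteq> A"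
      using k E finE by (auto simp: A_def stores_upto_def)
    have ck: "c k \<le> sum c E"
      using k(1) finE E c by (intro member_le_sum) force+
    then have "c j \<le> sum c E" if "j \<in> A" for j
      using that by (simp add: A_def stores_upto_def)
    moreover have "density_order c \<rho> A (ks (c k))"
      using order kN by (simp add: A_def)
    ultimately obtain X where X: "X \<in> insert {} (list_candidates (ks (c k)))"
        "sum c X \<le> sum c E" "prod \<rho> X \<le> sqrt (prod \<rho> E)"
      using ex_candidate_sqrt_prod[of c \<rho> A "ks (c k)" E] A c \<rho> by blast
    have "dss_cost c \<rho> \<beta> D \<le> dss_cost c \<rho> \<beta> X"
      using X(1) kN by (intro D_le) (auto simp: ds_knap_candidates_eq)
    also have "\<dots> \<le> sum c E + \<beta> * sqrt (prod \<rho> E)"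
      unfolding dss_cost_def using X \<beta> by (intro add_mono mult_left_mono) auto
    \<comment> \<open>The lower bound \<open>1 \<le> sum c E\<close> comes from \<open>k\<close>, a
      member of \<open>E\<close> of cost at least 1.\<close>
    also have "\<dots> \<le> 2 * sqrt \<beta> * (sum c E + \<beta> * prod \<rho> E)"
      using ck c[OF kN] \<beta> \<rho>(1) E by (intro sqrt_penalty_le prod_nonneg) auto
    finally show ?thesis
      by (simp add: opt dss_cost_def)
  qed
qed

text \<open>Supplies the exponent \<open>k\<close> for the sorting bound, the number of levels of
  the recursion.\<close>

lemma le_two_power_log: "n \<le> 2 ^ nat \<lceil>log 2 (real n)\<rceil>"
proof (cases "n = 0")
  case False
  have "real n = 2 powr log 2 (real n)"
    using False by simp
  also have "\<dots> \<le> 2 powr real (nat \<lceil>log 2 (real n)\<rceil>)"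
    by (intro powr_mono real_nat_ceiling_ge) simp
  also have "\<dots> = real (2 ^ nat \<lceil>log 2 (real n)\<rceil>)"
    by (simp add: powr_realpow)
  finally show ?thesis
    by (simp only: of_nat_le_iff)
qed simp

theorem theorem19:
  "\<exists>T :: nat \<Rightarrow> nat. (\<lambda>n. real (T n)) \<in> O(\<lambda>n. real n ^ 2 * log 2 (real n)) \<and>
    (\<forall>\<delta>::real. \<delta> < 1 \<longrightarrow>
      (\<exists>C::real. \<forall>(N :: 'a set) (c :: 'a \<Rightarrow> real) (\<rho> :: 'a \<Rightarrow> real) (\<beta>::real).
        dss_instance N c \<rho> \<beta> \<longrightarrow> (\<forall>j\<in>N. \<rho> j \<le> \<delta>) \<longrightarrow>
          (\<forall>D. ds_knap_output N c \<rho> \<beta> D \<longrightarrow>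
             D \<subseteq> N \<and> dss_cost c \<rho> \<beta> D \<le> C * sqrt \<beta> * dss_opt N c \<rho> \<beta>) \<and>
          (\<forall>js. distinct js \<longrightarrow> set js = N \<longrightarrow>
             ds_knap_output N c \<rho> \<beta> (set (val (ds_knap js c \<rho> \<beta>))) \<and>
             steps (ds_knap js c \<rho> \<beta>) \<le> T (card N))))"
proof (intro exI conjI allI impI)
  \<comment> \<open>This goal fixes the witness for \<open>T\<close>, the bound of
    \<open>steps_ds_knap\<close> with the rounded-up logarithm as \<open>k\<close>; the closing
    \<open>auto\<close> fixes \<open>C\<close> as 2.\<close>
  show "(\<lambda>n. real (3 + 14 * n + (16 + 7 * nat \<lceil>log 2 (real n)\<rceil>) * n\<^sup>2))
      \<in> O(\<lambda>n. real n ^ 2 * log 2 (real n))"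
    by (rule steps_bound_bigo)
next
  fix N :: "'a set" and c \<rho> :: "'a \<Rightarrow> real" and \<beta> :: real and js :: "'a list"
  assume "distinct js" "set js = N"
  then have "length js = card N"
    by (metis distinct_card)
  with le_two_power_log[of "card N"]
  show "steps (ds_knap js c \<rho> \<beta>)
      \<le> 3 + 14 * card N + (16 + 7 * nat \<lceil>log 2 (real (card N))\<rceil>) * (card N)\<^sup>2"
    by (metis steps_ds_knap)
qed (auto intro: ds_knap_output_approx(2) dest: ds_knap_output_approx(1) simp: ds_knap_output_val)

end
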